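(* Let $f:\mathbb{R}^d\to\mathbb{R}$ be continuously differentiable, $L$-smooth for some $L>0$, and bounded from below. Let $(\alpha_k)_{k\ge1}$ be positive step sizes with $\lim_{k\to\infty}\alpha_k=0$ and $\sum_{k=1}^\infty\alpha_k=\infty$. Let $x_0$ be an $\mathbb{R}^d$-valued random variable with $\mathbb{E}|f(x_0)|<\infty$, and let $(x_k)$ be generated by vanilla SGD, $x_k=x_{k-1}-\alpha_k\nabla f(x_{k-1})+\alpha_k\xi_k$ for $k\ge1$, where the $\mathbb{R}^d$-valued noise satisfies, for constants $M,V\ge0$ and all $k\ge1$, $$\mathbb{E}[\xi_k\mid\mathcal{F}_{k-1}]=0,\qquad \mathbb{E}[\|\xi_k\|^2\mid\mathcal{F}_{k-1}]\le M+V\|\nabla f(x_{k-1})\|^2 .$$ Then $$\liminf_{n\to\infty}\ \mathbb{E}\|\nabla f(x_n)\|^2=0 .$$ Furthermore, if $\sum_{k=1}^\infty\alpha_k^2<\infty$, then $$\lim_{n\to\infty}\ \mathbb{E}\|\nabla f(x_n)\|^2=0 .$$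
   Context: $\mathcal{F}_k=\sigma(x_0,\xi_1,\dots,\xi_k)$ is the filtration generated by the initial value and the noise. $f$ is $L$-smooth if $\|\nabla f(x)-\nabla f(y)\|\le L\|x-y\|$ for all $x,y\in\mathbb{R}^d$. *)

theory Defs
  imports "HOL-Probability.Probability"
begin

definition sgd_filtration ::
  "'w measure \<Rightarrow> ('w \<Rightarrow> 'a::euclidean_space) \<Rightarrow> (nat \<Rightarrow> 'w \<Rightarrow> 'a) \<Rightarrow> nat \<Rightarrow> 'w measure"
  where "sgd_filtration P x0 \<xi> k =
    sigma (space P)
      ({x0 -` A \<inter> space P | A. A \<in> sets borel} \<union>
       {\<xi> i -` A \<inter> space P | i A. i \<in> {1..k} \<and> A \<in> sets borel})"

lemma subalgebra_sgd_filtration: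
  assumes "x0 \<in> borel_measurable P"
    and "\<And>i. 1 \<le> i \<Longrightarrow> \<xi> i \<in> borel_measurable P"
  shows "subalgebra P (sgd_filtration P x0 \<xi> k)"
proof -
  let ?G = "{x0 -` A \<inter> space P | A. A \<in> sets borel} \<union>
    {\<xi> i -` A \<inter> space P | i A. i \<in> {1..k} \<and> A \<in> sets borel}"
  have "?G \<subseteq> Pow (space P)" by auto
  moreover have "?G \<subseteq> sets P"
    using assms by (auto intro: measurable_sets)
  then have "sigma_sets (space P) ?G \<subseteq> sets P"
    by (rule sets.sigma_sets_subset)
  ultimately show ?thesis
    unfolding subalgebra_def sgd_filtration_def
    by (simp add: space_measure_of sets_measure_of)
qed

(* Coordinatewise conditional expectation. Like real_cond_exp it is total, but it is only
   meaningful when E[norm X | F] is finite almost surely. *)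
definition vec_cond_exp ::
  "'w measure \<Rightarrow> 'w measure \<Rightarrow> ('w \<Rightarrow> 'a::euclidean_space) \<Rightarrow> 'w \<Rightarrow> 'a"
  where "vec_cond_exp P F X \<omega> =
    (\<Sum>b\<in>Basis. real_cond_exp P F (\<lambda>\<omega>'. X \<omega>' \<bullet> b) \<omega> *\<^sub>R b)"

end

theory Submission
  imports Defs
begin

text \<open>
  Let \<open>m\<close> be a lower bound of \<open>f\<close>, \<open>a n = E[f (x n) - m]\<close> and \<open>G n = E[norm (gradf (x n))^2]\<close>.
  The descent inequality for \<open>L\<close>-smooth functions and the two conditional moment assumptions give
  \<open>a (n + 1) \<le> a n - t G n + K t^2 (G n + 1)\<close> with \<open>t = \<alpha> (n + 1)\<close>, and \<open>G n \<le> 2 L a n\<close>.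
  If \<open>G\<close> stayed away from \<open>0\<close>, then \<open>a\<close> would eventually lose a fixed multiple of \<open>t\<close> in each
  step, contradicting the divergence of the step size sum.
  If the squared step sizes are summable, then \<open>a\<close> and hence \<open>G\<close> is bounded, \<open>t G n\<close> is
  summable, and \<open>\<bar>G (n + 1) - G n\<bar> \<le> B t\<close>. Hence
  \<open>\<bar>(G (n + 1))^2 - (G n)^2\<bar> \<le> B t (2 G n + B t)\<close> is summable, so that \<open>G\<close> converges, and its
  limit is the limes inferior.
\<close>

section \<open>Real sequences\<close>

text \<open>Summing the recursion from the threshold \<open>N\<close> on telescopes to one
  inequality: \<open>a (m + N)\<close> plus a partial sum of \<open>t\<close> is at most
  \<open>a N\<close> plus the total error. Dropping the first nonnegative summand bounds the partial
  sums of \<open>t\<close>; dropping the second bounds \<open>a\<close>.\<close>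

lemma telescoping_descent:
  fixes a t e :: "nat \<Rightarrow> real"
  assumes a: "\<And>n. 0 \<le> a n" and t: "\<And>n. 0 \<le> t n" and e: "\<And>n. 0 \<le> e n"
    and sum: "summable e"
    and step: "eventually (\<lambda>n. a (Suc n) \<le> a n - t n + e n) sequentially"
  shows "summable t" and "\<exists>B. \<forall>n. a n \<le> B"
proof -
  obtain N where N: "\<And>n. n \<ge> N \<Longrightarrow> a (Suc n) \<le> a n - t n + e n"
    using step unfolding eventually_sequentially by blast
  have "a (m + N) + (\<Sum>i<m. t (i + N)) \<le> a N + (\<Sum>i<m. e (i + N))" for m
  proof (induction m)
    case (Suc m)
    then show ?case using N[of "m + N"] by simp
  qed simp
  moreover have "(\<Sum>i<m. e (i + N)) \<le> (\<Sum>i. e (i + N))" for m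
    using sum e by (intro sum_le_suminf) (auto simp: summable_iff_shift)
  ultimately have bound: "a (m + N) + (\<Sum>i<m. t (i + N)) \<le> a N + (\<Sum>i. e (i + N))" for m
    by (meson add_left_mono order_trans)
  have "summable (\<lambda>i. t (i + N))"
  proof (rule bounded_imp_summable)
    fix m
    show "(\<Sum>i\<le>m. t (i + N)) \<le> a N + (\<Sum>i. e (i + N))"
      using bound[of "Suc m"] a[of "Suc m + N"] by (simp add: lessThan_Suc_atMost)
  qed (rule t)
  then show "summable t" by (simp add: summable_iff_shift)
  \<comment> \<open>The maximum covers the indices up to \<open>N\<close>, the telescoped inequality
    the later ones. Both summands are nonnegative, so their sum serves in either case.\<close>
  have "a n \<le> Max (a ` {..N}) + (a N + (\<Sum>i. e (i + N)))" for n
  proof (cases "n \<le> N")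
    case True
    then have "a n \<le> Max (a ` {..N})" by simp
    moreover have "0 \<le> (\<Sum>i. e (i + N))"
      using sum e by (intro suminf_nonneg) (auto simp: summable_iff_shift)
    ultimately show ?thesis using a[of N] by simp
  next
    case False
    have "a N \<le> Max (a ` {..N})" by simp
    have "0 \<le> (\<Sum>i<n - N. t (i + N))" by (simp add: t sum_nonneg)
    with False have "a n \<le> a N + (\<Sum>i. e (i + N))"
      using bound[of "n - N"] by simp
    with \<open>a N \<le> Max (a ` {..N})\<close> a[of N] show ?thesis by linarith
  qed
  then show "\<exists>B. \<forall>n. a n \<le> B" by blast
qed

text \<open>If \<open>c \<le> G n\<close> eventually, the error is absorbed by half of the drift
  once \<open>t n\<close> is small. Then \<open>a\<close> loses at least \<open>c / 2 * t n\<close>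
  per step, and telescoping makes \<open>t\<close> summable.\<close>

lemma frequently_small_of_descent:
  fixes a t G :: "nat \<Rightarrow> real"
  assumes a: "\<And>n. 0 \<le> a n" and t: "\<And>n. 0 < t n"
    and K: "0 \<le> K" and t0: "t \<longlonglongrightarrow> 0" and div: "\<not> summable t"
    and step: "\<And>n. a (Suc n) \<le> a n - t n * G n + K * (t n)\<^sup>2 * (G n + 1)"
    and c: "0 < c"
  shows "\<exists>\<^sub>F n in sequentially. G n < c"
proof (rule ccontr)
  assume "\<not> ?thesis"
  then have ev: "\<forall>\<^sub>F n in sequentially. c \<le> G n"
    by (simp add: not_frequently not_less)
  \<comment> \<open>The factor \<open>1 + 1 / c\<close> arises because \<open>c \<le> G n\<close>
    gives \<open>1 \<le> G n / c\<close>, so that the error becomes a multiple of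
    \<open>G n\<close>.\<close>
  have "(\<lambda>n. K * (1 + 1 / c) * t n) \<longlonglongrightarrow> K * (1 + 1 / c) * 0"
    by (intro tendsto_intros t0)
  then have "\<forall>\<^sub>F n in sequentially. K * (1 + 1 / c) * t n < 1 / 2"
    by (rule order_tendstoD) simp
  with ev have "\<forall>\<^sub>F n in sequentially. a (Suc n) \<le> a n - c / 2 * t n + 0"
  proof eventually_elim
    case (elim n)
    have "G n + 1 \<le> (1 + 1 / c) * G n"
      using elim(1) c by (simp add: field_simps)
    then have "K * t n * (G n + 1) \<le> K * t n * ((1 + 1 / c) * G n)"
      using K t[of n] by (intro mult_left_mono) auto
    also have "\<dots> = (K * (1 + 1 / c) * t n) * G n" by (simp add: mult_ac)
    also have "\<dots> \<le> 1 / 2 * G n"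
      using elim c by (intro mult_right_mono) auto
    finally have "t n * (K * t n * (G n + 1)) \<le> t n * (1 / 2 * G n)"
      using t[of n] by (intro mult_left_mono) auto
    moreover have "t n * c \<le> t n * G n"
      using elim(1) t[of n] by simp
    moreover have "t n * (K * t n * (G n + 1)) = K * (t n)\<^sup>2 * (G n + 1)"
      by (simp add: power2_eq_square mult_ac)
    moreover have "t n * (1 / 2 * G n) = 1 / 2 * (t n * G n)" "c / 2 * t n = 1 / 2 * (t n * c)"
      by simp_all
    ultimately show ?case using step[of n] by linarith
  qed
  then have "summable (\<lambda>n. c / 2 * t n)"
    by (rule telescoping_descent(1)[of a _ "\<lambda>_. 0", rotated -1]) (use a t c in \<open>auto simp: less_imp_le\<close>)
  then show False using div c by (simp add: summable_cmult_iff)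
qed

text \<open>As soon as \<open>K * t n < 1 / 2\<close>, the part of the error proportional to
  \<open>G n\<close> is absorbed by half of the drift. What remains is
  \<open>K * (t n)\<^sup>2\<close>, a summable error.\<close>

lemma summable_of_descent:
  fixes a t G :: "nat \<Rightarrow> real"
  assumes a: "\<And>n. 0 \<le> a n" and t: "\<And>n. 0 < t n" and G: "\<And>n. 0 \<le> G n"
    and K: "0 \<le> K" and t2: "summable (\<lambda>n. (t n)\<^sup>2)" and t0: "t \<longlonglongrightarrow> 0"
    and step: "\<And>n. a (Suc n) \<le> a n - t n * G n + K * (t n)\<^sup>2 * (G n + 1)"
  shows "summable (\<lambda>n. t n * G n)" and "\<exists>B. \<forall>n. a n \<le> B"
proof -
  have "(\<lambda>n. K * t n) \<longlonglongrightarrow> K * 0"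
    by (intro tendsto_intros t0)
  then have "\<forall>\<^sub>F n in sequentially. K * t n < 1 / 2"
    by (rule order_tendstoD) simp
  then have ev: "\<forall>\<^sub>F n in sequentially. a (Suc n) \<le> a n - 1 / 2 * (t n * G n) + K * (t n)\<^sup>2"
  proof eventually_elim
    case (elim n)
    then have "(K * t n) * (t n * G n) \<le> 1 / 2 * (t n * G n)"
      using t[of n] G[of n] by (intro mult_right_mono) auto
    then show ?case using step[of n] by (simp add: power2_eq_square algebra_simps)
  qed
  have "summable (\<lambda>n. 1 / 2 * (t n * G n))"
    by (rule telescoping_descent(1)[OF _ _ _ _ ev])
      (use a t G K t2 in \<open>auto simp: less_imp_le intro: summable_mult\<close>)
  then show "summable (\<lambda>n. t n * G n)" by (simp add: summable_cmult_iff)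
  show "\<exists>B. \<forall>n. a n \<le> B"
    by (rule telescoping_descent(2)[OF _ _ _ _ ev])
      (use a t G K t2 in \<open>auto simp: less_imp_le intro: summable_mult\<close>)
qed

text \<open>The bound \<open>B * t n\<close> on the increments of \<open>G\<close> need not be
  summable. Increments of the square carry the extra factor \<open>G (Suc n) + G n\<close>, which is
  at most \<open>2 * G n + B * t n\<close>, and this produces the two summable series. Taking roots
  returns to \<open>G\<close>, as \<open>G\<close> is nonnegative.\<close>

lemma convergent_of_slow_variation:
  fixes t G :: "nat \<Rightarrow> real"
  assumes t: "\<And>n. 0 \<le> t n" and G: "\<And>n. 0 \<le> G n"
    and t2: "summable (\<lambda>n. (t n)\<^sup>2)" and tG: "summable (\<lambda>n. t n * G n)"
    and var: "\<And>n. \<bar>G (Suc n) - G n\<bar> \<le> B * t n"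
  shows "convergent G"
proof -
  have "norm ((G (Suc n))\<^sup>2 - (G n)\<^sup>2) \<le> 2 * B * (t n * G n) + B\<^sup>2 * (t n)\<^sup>2" for n
  proof -
    have "norm ((G (Suc n))\<^sup>2 - (G n)\<^sup>2) = \<bar>G (Suc n) - G n\<bar> * (G (Suc n) + G n)"
      using G[of n] G[of "Suc n"] by (simp add: power2_eq_square square_diff_square_factored abs_mult)
    also have "\<dots> \<le> (B * t n) * (2 * G n + B * t n)"
    proof (rule mult_mono)
      \<comment> \<open>The sign comes from \<open>var\<close>, where \<open>B * t n\<close> bounds
        an absolute value.\<close>
      show "0 \<le> B * t n" using var[of n] by linarith
    qed (use var[of n] G[of n] G[of "Suc n"] in auto)
    finally show ?thesis by (simp add: power2_eq_square algebra_simps)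
  qed
  moreover have "summable (\<lambda>n. 2 * B * (t n * G n) + B\<^sup>2 * (t n)\<^sup>2)"
    by (intro summable_add summable_mult tG t2)
  ultimately have "summable (\<lambda>n. (G (Suc n))\<^sup>2 - (G n)\<^sup>2)"
    by (rule summable_comparison_test'[where N = 0, rotated])
  then have "convergent (\<lambda>n. \<Sum>i<n. (G (Suc i))\<^sup>2 - (G i)\<^sup>2)"
    by (simp add: summable_iff_convergent)
  then obtain l where "(\<lambda>n. (G n)\<^sup>2 - (G 0)\<^sup>2) \<longlonglongrightarrow> l"
    by (auto simp: convergent_def sum_lessThan_telescope[of "\<lambda>n. (G n)\<^sup>2"])
  then have "(\<lambda>n. sqrt ((G n)\<^sup>2 - (G 0)\<^sup>2 + (G 0)\<^sup>2)) \<longlonglongrightarrow> sqrt (l + (G 0)\<^sup>2)"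
    by (intro tendsto_intros)
  then show ?thesis using G by (auto simp: convergent_def)
qed

section \<open>Smooth functions\<close>

locale smooth_bounded_below =
  fixes f :: "'a::euclidean_space \<Rightarrow> real" and gradf :: "'a \<Rightarrow> 'a" and L m :: real
  assumes grad: "\<And>y. GDERIV f y :> gradf y"
    and L_pos: "0 < L"
    and grad_lipschitz: "\<And>y z. norm (gradf y - gradf z) \<le> L * norm (y - z)"
    and lower: "\<And>y. m \<le> f y"
begin

text \<open>On the segment from \<open>y\<close> to \<open>y + h\<close>, \<open>\<phi>\<close> is
  \<open>f\<close> minus its linear part and the quadratic term. Cauchy-Schwarz and the Lipschitz
  bound make its derivative nonpositive, so \<open>\<phi> 1 \<le> \<phi> 0\<close>.\<close>

lemma descent: "f (y + h) \<le> f y + gradf y \<bullet> h + L / 2 * (norm h)\<^sup>2"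
proof -
  define \<phi> where "\<phi> s = f (y + s *\<^sub>R h) - s * (gradf y \<bullet> h) - L / 2 * s\<^sup>2 * (norm h)\<^sup>2" for s :: real
  have "\<phi> 1 \<le> \<phi> 0"
  proof (rule DERIV_nonpos_imp_nonincreasing[where f = \<phi>])
    fix s :: real assume s: "0 \<le> s"
    let ?d = "(gradf (y + s *\<^sub>R h) - gradf y) \<bullet> h - L * s * (norm h)\<^sup>2"
    have f': "(f has_derivative (\<lambda>k. k \<bullet> gradf (y + s *\<^sub>R h))) (at (y + s *\<^sub>R h))"
      using grad by (simp add: gderiv_def)
    have "((\<lambda>s. y + s *\<^sub>R h) has_derivative (\<lambda>r. r *\<^sub>R h)) (at s)"
      by (auto intro!: derivative_eq_intros)
    from has_derivative_compose[OF this f']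
    have "((\<lambda>s. f (y + s *\<^sub>R h)) has_real_derivative (h \<bullet> gradf (y + s *\<^sub>R h))) (at s)"
      unfolding has_field_derivative_def by (simp add: mult_commute_abs)
    then have "(\<phi> has_real_derivative ?d) (at s)"
      unfolding \<phi>_def
      by (auto intro!: derivative_eq_intros simp: inner_commute inner_diff_right)
    moreover have "(gradf (y + s *\<^sub>R h) - gradf y) \<bullet> h \<le> (L * (s * norm h)) * norm h"
      using grad_lipschitz[of "y + s *\<^sub>R h" y] s
      by (intro order_trans[OF norm_cauchy_schwarz] mult_right_mono) auto
    ultimately show "\<exists>d. (\<phi> has_real_derivative d) (at s) \<and> d \<le> 0"
      by (intro exI[of _ ?d]) (auto simp: power2_eq_square)
  qed simp
  then show ?thesis by (simp add: \<phi>_def)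
qed

text \<open>A gradient step of size \<open>1 / L\<close>, which minimizes the quadratic upper bound,
  lowers \<open>f\<close> by at least the squared gradient norm over \<open>2 * L\<close>, yet
  cannot lead below \<open>m\<close>.\<close>

lemma grad_norm_bound: "(norm (gradf y))\<^sup>2 \<le> 2 * L * (f y - m)"
proof -
  have "m \<le> f (y + (- (1 / L)) *\<^sub>R gradf y)" by (rule lower)
  also have "\<dots> \<le> f y - (norm (gradf y))\<^sup>2 / (2 * L)"
    using descent[of y "(- (1 / L)) *\<^sub>R gradf y"] L_pos
    by (simp add: power_divide power2_norm_eq_inner power2_eq_square[of L] field_simps)
  finally show ?thesis using L_pos by (simp add: field_simps)
qed

lemma f_borel [measurable]: "f \<in> borel_measurable borel"
  using grad by (intro borel_measurable_continuous_onI)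
    (auto simp: gderiv_def continuous_on_eq_continuous_at intro!: has_derivative_continuous)

lemma gradf_borel [measurable]: "gradf \<in> borel_measurable borel"
proof (intro borel_measurable_continuous_onI)
  have "L-lipschitz_on UNIV gradf"
    using grad_lipschitz L_pos by (auto simp: lipschitz_on_def dist_norm)
  then show "continuous_on UNIV gradf"
    by (rule lipschitz_on_continuous_on)
qed

lemma integrable_norm_grad:
  assumes "finite_measure N" and [measurable]: "X \<in> borel_measurable N"
    and "integrable N (\<lambda>w. f (X w))"
  shows "integrable N (\<lambda>w. (norm (gradf (X w)))\<^sup>2)"
proof (rule Bochner_Integration.integrable_bound)
  interpret finite_measure N by fact
  show "integrable N (\<lambda>w. 2 * L * (f (X w) - m))"
    using assms by auto
  have "(norm (gradf (X w)))\<^sup>2 \<le> \<bar>2 * L * (f (X w) - m)\<bar>" for w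
    using grad_norm_bound[of "X w"] abs_ge_self order_trans by blast
  then show "AE w in N. norm ((norm (gradf (X w)))\<^sup>2) \<le> norm (2 * L * (f (X w) - m))"
    by simp
qed simp

text \<open>The difference of squares is factored and both factors are bounded by the Lipschitz
  property. The mixed term \<open>2 * norm d * norm (gradf y)\<close> is split into squares, so that
  only second moments appear after integration.\<close>

lemma grad_norm_variation:
  "\<bar>(norm (gradf (y + t *\<^sub>R d)))\<^sup>2 - (norm (gradf y))\<^sup>2\<bar>
    \<le> \<bar>t\<bar> * (L * ((norm d)\<^sup>2 + (norm (gradf y))\<^sup>2) + L\<^sup>2 * \<bar>t\<bar> * (norm d)\<^sup>2)"
proof -
  let ?p = "norm (gradf (y + t *\<^sub>R d))" and ?q = "norm (gradf y)" and ?r = "L * (\<bar>t\<bar> * norm d)"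
  have r: "\<bar>?p - ?q\<bar> \<le> ?r"
    using order_trans[OF norm_triangle_ineq3 grad_lipschitz[of "y + t *\<^sub>R d" y]] by simp
  have "\<bar>?p\<^sup>2 - ?q\<^sup>2\<bar> = \<bar>?p - ?q\<bar> * (?p + ?q)"
    by (simp add: power2_eq_square square_diff_square_factored abs_mult)
  also have "\<dots> \<le> ?r * (2 * ?q + ?r)"
    using r L_pos by (intro mult_mono) auto
  also have "\<dots> = \<bar>t\<bar> * (L * (2 * norm d * ?q) + L\<^sup>2 * \<bar>t\<bar> * (norm d)\<^sup>2)"
    by (simp add: power2_eq_square algebra_simps)
  also have "\<dots> \<le> \<bar>t\<bar> * (L * ((norm d)\<^sup>2 + ?q\<^sup>2) + L\<^sup>2 * \<bar>t\<bar> * (norm d)\<^sup>2)"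
    using L_pos sum_squares_bound[of "norm d" ?q]
    by (intro mult_left_mono add_right_mono) auto
  finally show ?thesis .
qed

end

section \<open>Conditionally centered noise\<close>

lemma integrable_inner_of_squares:
  fixes U W :: "'w \<Rightarrow> 'a::euclidean_space"
  assumes [measurable]: "U \<in> borel_measurable N" "W \<in> borel_measurable N"
    and "integrable N (\<lambda>w. (norm (U w))\<^sup>2)" "integrable N (\<lambda>w. (norm (W w))\<^sup>2)"
  shows "integrable N (\<lambda>w. U w \<bullet> W w)"
proof (rule Bochner_Integration.integrable_bound)
  show "integrable N (\<lambda>w. (norm (U w))\<^sup>2 + (norm (W w))\<^sup>2)"
    using assms by auto
  have "\<bar>U w \<bullet> W w\<bar> \<le> (norm (U w))\<^sup>2 + (norm (W w))\<^sup>2" for w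
  proof -
    have "\<bar>U w \<bullet> W w\<bar> \<le> norm (U w) * norm (W w)" by (rule Cauchy_Schwarz_ineq2)
    moreover have "0 \<le> norm (U w) * norm (W w)" by simp
    ultimately show ?thesis
      using sum_squares_bound[of "norm (U w)" "norm (W w)"] by linarith
  qed
  then show "AE w in N. norm (U w \<bullet> W w) \<le> norm ((norm (U w))\<^sup>2 + (norm (W w))\<^sup>2)"
    by simp
qed simp

context sigma_finite_subalgebra
begin

text \<open>In each coordinate the \<open>F\<close>-measurable factor can be pulled out of the
  conditional expectation, which leaves the integral of \<open>U w \<bullet> b\<close> times a
  function that vanishes almost everywhere. The second moments make the coordinate products
  integrable, as this requires.\<close>

lemma integral_inner_eq_0_of_vec_cond_exp_eq_0:
  fixes U W :: "'a \<Rightarrow> 'b::euclidean_space"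
  assumes U [measurable]: "U \<in> borel_measurable F" and W [measurable]: "W \<in> borel_measurable M"
    and sq: "integrable M (\<lambda>w. (norm (U w))\<^sup>2)" "integrable M (\<lambda>w. (norm (W w))\<^sup>2)"
    and cond: "AE w in M. vec_cond_exp M F W w = 0"
  shows "(\<integral>w. U w \<bullet> W w \<partial>M) = 0"
proof -
  have UM [measurable]: "U \<in> borel_measurable M"
    using measurable_from_subalg[OF subalg U] .
  have int: "integrable M (\<lambda>w. (U w \<bullet> b) * (W w \<bullet> b))" if b: "b \<in> Basis" for b
  proof -
    have *: "integrable M (\<lambda>w. (norm (Z w \<bullet> b))\<^sup>2)"
      if [measurable]: "Z \<in> borel_measurable M" and "integrable M (\<lambda>w. (norm (Z w))\<^sup>2)"
      for Z :: "'a \<Rightarrow> 'b"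
      by (rule Bochner_Integration.integrable_bound[OF that(2)])
        (use Basis_le_norm[OF b] in \<open>auto intro!: AE_I2 simp flip: abs_le_square_iff\<close>)
    show ?thesis
      using integrable_inner_of_squares[of "\<lambda>w. U w \<bullet> b" M "\<lambda>w. W w \<bullet> b"] * sq by simp
  qed
  have zero: "(\<integral>w. (U w \<bullet> b) * (W w \<bullet> b) \<partial>M) = 0" if b: "b \<in> Basis" for b
  proof -
    have "AE w in M. real_cond_exp M F (\<lambda>w. W w \<bullet> b) w = 0"
      using cond
    proof eventually_elim
      case (elim w)
      then have "vec_cond_exp M F W w \<bullet> b = 0" by simp
      then show ?case
        using b by (simp add: vec_cond_exp_def inner_sum_left inner_Basis if_distrib cong: if_cong)
    qed
    then have "(\<integral>w. (U w \<bullet> b) * real_cond_exp M F (\<lambda>w. W w \<bullet> b) w \<partial>M) = 0"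
      by (intro integral_eq_zero_AE) auto
    then show ?thesis
      using real_cond_exp_intg(2)[OF int[OF b]] by simp
  qed
  have "(\<integral>w. U w \<bullet> W w \<partial>M) = (\<Sum>b\<in>Basis. \<integral>w. (U w \<bullet> b) * (W w \<bullet> b) \<partial>M)"
    by (subst euclidean_inner) (auto intro!: Bochner_Integration.integral_sum int)
  also have "\<dots> = 0" using zero by simp
  finally show ?thesis .
qed

text \<open>The conditional bound is integrated, and conditioning preserves nonnegative integrals.
  The computation stays in \<open>ennreal\<close> until finiteness of the second moment has been
  derived.\<close>

lemma second_moment_of_nn_cond_exp_le:
  fixes W :: "'a \<Rightarrow> 'b::euclidean_space"
  assumes W [measurable]: "W \<in> borel_measurable M"
    and R: "integrable M R" "\<And>w. 0 \<le> R w"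
    and bound: "AE w in M. nn_cond_exp M F (\<lambda>w. ennreal ((norm (W w))\<^sup>2)) w \<le> ennreal (R w)"
  shows "integrable M (\<lambda>w. (norm (W w))\<^sup>2)" and "(\<integral>w. (norm (W w))\<^sup>2 \<partial>M) \<le> (\<integral>w. R w \<partial>M)"
proof -
  have "(\<integral>\<^sup>+w. ennreal ((norm (W w))\<^sup>2) \<partial>M)
      = (\<integral>\<^sup>+w. nn_cond_exp M F (\<lambda>w. ennreal ((norm (W w))\<^sup>2)) w \<partial>M)"
    using nn_cond_exp_intg[of "\<lambda>_. 1" "\<lambda>w. ennreal ((norm (W w))\<^sup>2)"] by simp
  also have "\<dots> \<le> (\<integral>\<^sup>+w. ennreal (R w) \<partial>M)"
    by (rule nn_integral_mono_AE[OF bound])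
  also have "\<dots> = ennreal (\<integral>w. R w \<partial>M)"
    using R by (simp add: nn_integral_eq_integral)
  finally have le: "(\<integral>\<^sup>+w. ennreal ((norm (W w))\<^sup>2) \<partial>M) \<le> ennreal (\<integral>w. R w \<partial>M)" .
  show int: "integrable M (\<lambda>w. (norm (W w))\<^sup>2)"
  proof (rule integrableI_nonneg)
    show "(\<integral>\<^sup>+w. ennreal ((norm (W w))\<^sup>2) \<partial>M) < \<infinity>"
      using le by (rule order_le_less_trans) simp
  qed auto
  have "ennreal (\<integral>w. (norm (W w))\<^sup>2 \<partial>M) \<le> ennreal (\<integral>w. R w \<partial>M)"
    using le int by (simp add: nn_integral_eq_integral)
  then show "(\<integral>w. (norm (W w))\<^sup>2 \<partial>M) \<le> (\<integral>w. R w \<partial>M)"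
    using R(2) by (simp add: ennreal_le_iff integral_nonneg_AE)
qed

end

section \<open>One step of stochastic gradient descent\<close>

context smooth_bounded_below
begin

text \<open>Here \<open>X\<close> and \<open>Y\<close> are consecutive iterates, \<open>W\<close> is
  the noise between them and \<open>F\<close> is the information before it. The pathwise
  inequalities are integrated; the cross term of \<open>gradf (X w)\<close> with \<open>W w\<close>
  has mean zero because \<open>X\<close> is \<open>F\<close>-measurable.\<close>

lemma sgd_step:
  fixes X Y W :: "'w \<Rightarrow> 'a"
  assumes P: "prob_space P" and F: "subalgebra P F"
    and X: "X \<in> borel_measurable F" and W: "W \<in> borel_measurable P"
    and Y: "\<And>w. w \<in> space P \<Longrightarrow> Y w = X w - t *\<^sub>R gradf (X w) + t *\<^sub>R W w"
    and t: "0 \<le> t" and M: "0 \<le> M" and V: "0 \<le> V"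
    and intX: "integrable P (\<lambda>w. f (X w))"
    and mean: "AE w in P. vec_cond_exp P F W w = 0"
    and var: "AE w in P. nn_cond_exp P F (\<lambda>w. ennreal ((norm (W w))\<^sup>2)) w
        \<le> ennreal (M + V * (norm (gradf (X w)))\<^sup>2)"
  defines "G \<equiv> \<lambda>Z. \<integral>w. (norm (gradf (Z w)))\<^sup>2 \<partial>P"
  shows "integrable P (\<lambda>w. f (Y w))"
    and "(\<integral>w. f (Y w) \<partial>P) \<le> (\<integral>w. f (X w) \<partial>P) - t * G X + L / 2 * t\<^sup>2 * (G X + (M + V * G X))"
    and "\<bar>G Y - G X\<bar> \<le> t * (L * (G X + (M + V * G X) + G X) + L\<^sup>2 * t * (G X + (M + V * G X)))"
proof -
  interpret prob_space P by fact
  interpret finite_measure_subalgebra P F by unfold_locales (rule F)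
  note [measurable] = W
  have XP [measurable]: "X \<in> borel_measurable P"
    using measurable_from_subalg[OF F X] .
  have gX: "(\<lambda>w. gradf (X w)) \<in> borel_measurable F"
    using X by measurable
  have "(\<lambda>w. X w - t *\<^sub>R gradf (X w) + t *\<^sub>R W w) \<in> borel_measurable P"
    by measurable
  then have YP [measurable]: "Y \<in> borel_measurable P"
    by (subst measurable_cong[OF Y])
  have intG: "integrable P (\<lambda>w. (norm (gradf (X w)))\<^sup>2)"
    by (rule integrable_norm_grad[OF _ XP intX]) unfold_locales
  have R: "integrable P (\<lambda>w. M + V * (norm (gradf (X w)))\<^sup>2)"
    using intG by simp
  have intW: "integrable P (\<lambda>w. (norm (W w))\<^sup>2)"
    and W_le': "(\<integral>w. (norm (W w))\<^sup>2 \<partial>P) \<le> (\<integral>w. M + V * (norm (gradf (X w)))\<^sup>2 \<partial>P)"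
    using second_moment_of_nn_cond_exp_le[OF W R _ var] M V by auto
  have W_le: "(\<integral>w. (norm (W w))\<^sup>2 \<partial>P) \<le> M + V * G X"
    using W_le' intG by (simp add: G_def prob_space)
  have intI: "integrable P (\<lambda>w. gradf (X w) \<bullet> W w)"
    by (rule integrable_inner_of_squares[OF _ W intG intW]) measurable
  have zero: "(\<integral>w. gradf (X w) \<bullet> W w \<partial>P) = 0"
    by (rule integral_inner_eq_0_of_vec_cond_exp_eq_0[OF gX W intG intW mean])
  \<comment> \<open>The direction of the step, so that \<open>Y\<close> is \<open>X\<close> plus
    \<open>t\<close> times \<open>D\<close>. Expanding its square and using the vanishing cross term
    bounds its second moment by \<open>G X + (M + V * G X)\<close>.\<close>
  define D where "D w = W w - gradf (X w)" for w
  have [measurable]: "D \<in> borel_measurable P" unfolding D_def by measurable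
  have Y_eq: "Y w = X w + t *\<^sub>R D w" if "w \<in> space P" for w
    using Y[OF that] by (simp add: D_def algebra_simps)
  have D_sq: "(norm (D w))\<^sup>2 = (norm (gradf (X w)))\<^sup>2 + (norm (W w))\<^sup>2 - 2 * (gradf (X w) \<bullet> W w)" for w
    by (simp add: D_def power2_norm_eq_inner inner_diff_left inner_diff_right inner_commute)
  have intD: "integrable P (\<lambda>w. (norm (D w))\<^sup>2)"
    unfolding D_sq using intG intW intI by simp
  have D_le: "(\<integral>w. (norm (D w))\<^sup>2 \<partial>P) \<le> G X + (M + V * G X)"
    unfolding D_sq using intG intW intI zero W_le by (simp add: G_def)

  \<comment> \<open>The right-hand side of \<open>descent\<close> for the displacement
    \<open>t *\<^sub>R D w\<close>. Lying between \<open>m\<close> and the integrable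
    \<open>U\<close>, \<open>f (Y w)\<close> is integrable as well.\<close>
  define U where "U w = f (X w) + t * (gradf (X w) \<bullet> W w - (norm (gradf (X w)))\<^sup>2)
      + L / 2 * t\<^sup>2 * (norm (D w))\<^sup>2" for w
  have intU: "integrable P U"
    unfolding U_def using intX intG intI intD by simp
  have fY_le: "f (Y w) \<le> U w" if "w \<in> space P" for w
  proof -
    have "gradf (X w) \<bullet> (t *\<^sub>R D w) = t * (gradf (X w) \<bullet> W w - (norm (gradf (X w)))\<^sup>2)"
      by (simp add: D_def power2_norm_eq_inner inner_diff_right)
    then show ?thesis
      using descent[of "X w" "t *\<^sub>R D w"]
      unfolding Y_eq[OF that] U_def by (simp add: power_mult_distrib del: inner_scaleR_right)
  qed
  show intY: "integrable P (\<lambda>w. f (Y w))"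
  proof (rule Bochner_Integration.integrable_bound)
    show "integrable P (\<lambda>w. \<bar>U w\<bar> + \<bar>m\<bar>)" using intU by simp
    show "AE w in P. norm (f (Y w)) \<le> norm (\<bar>U w\<bar> + \<bar>m\<bar>)"
    proof (rule AE_I2)
      fix w assume "w \<in> space P"
      then show "norm (f (Y w)) \<le> norm (\<bar>U w\<bar> + \<bar>m\<bar>)"
        using fY_le[of w] lower[of "Y w"] by simp
    qed
  qed measurable
  have "(\<integral>w. f (Y w) \<partial>P) \<le> (\<integral>w. U w \<partial>P)"
    using intY intU fY_le by (rule integral_mono)
  also have "\<dots> = (\<integral>w. f (X w) \<partial>P) - t * G X + L / 2 * t\<^sup>2 * (\<integral>w. (norm (D w))\<^sup>2 \<partial>P)"
    unfolding U_def using intX intG intI intD zero by (simp add: G_def)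
  also have "\<dots> \<le> (\<integral>w. f (X w) \<partial>P) - t * G X + L / 2 * t\<^sup>2 * (G X + (M + V * G X))"
    using D_le L_pos by (intro add_left_mono mult_left_mono) auto
  finally show "(\<integral>w. f (Y w) \<partial>P)
      \<le> (\<integral>w. f (X w) \<partial>P) - t * G X + L / 2 * t\<^sup>2 * (G X + (M + V * G X))" .

  have intGY: "integrable P (\<lambda>w. (norm (gradf (Y w)))\<^sup>2)"
    by (rule integrable_norm_grad[OF _ YP intY]) unfold_locales
  have "\<bar>G Y - G X\<bar> = \<bar>\<integral>w. (norm (gradf (Y w)))\<^sup>2 - (norm (gradf (X w)))\<^sup>2 \<partial>P\<bar>"
    using intG intGY by (simp add: G_def)
  also have "\<dots> \<le> (\<integral>w. \<bar>(norm (gradf (Y w)))\<^sup>2 - (norm (gradf (X w)))\<^sup>2\<bar> \<partial>P)"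
    by (rule integral_abs_bound)
  also have "\<dots> \<le> (\<integral>w. t * (L * ((norm (D w))\<^sup>2 + (norm (gradf (X w)))\<^sup>2)
      + L\<^sup>2 * t * (norm (D w))\<^sup>2) \<partial>P)"
  proof (rule integral_mono)
    fix w assume "w \<in> space P"
    then show "\<bar>(norm (gradf (Y w)))\<^sup>2 - (norm (gradf (X w)))\<^sup>2\<bar>
        \<le> t * (L * ((norm (D w))\<^sup>2 + (norm (gradf (X w)))\<^sup>2) + L\<^sup>2 * t * (norm (D w))\<^sup>2)"
      using grad_norm_variation[of "X w" t "D w"] t by (simp add: Y_eq)
  qed (use intG intGY intD in auto)
  also have "\<dots> = t * (L * ((\<integral>w. (norm (D w))\<^sup>2 \<partial>P) + G X) + L\<^sup>2 * t * (\<integral>w. (norm (D w))\<^sup>2 \<partial>P))"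
    using intG intD by (simp add: G_def)
  also have "\<dots> \<le> t * (L * (G X + (M + V * G X) + G X) + L\<^sup>2 * t * (G X + (M + V * G X)))"
    using D_le L_pos t by (intro mult_left_mono add_mono) auto
  finally show "\<bar>G Y - G X\<bar>
      \<le> t * (L * (G X + (M + V * G X) + G X) + L\<^sup>2 * t * (G X + (M + V * G X)))" .
qed

end

section \<open>The filtration\<close>

lemma space_sgd_filtration [simp]: "space (sgd_filtration P x0 \<xi> k) = space P"
  unfolding sgd_filtration_def by (rule space_measure_of) auto

lemma measurable_sgd_filtration_initial: "x0 \<in> borel_measurable (sgd_filtration P x0 \<xi> k)"
  unfolding sgd_filtration_def
  by (rule measurableI) (auto simp: space_measure_of_conv intro!: in_measure_of)

lemma measurable_sgd_filtration_noise:
  assumes "1 \<le> i" "i \<le> k"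
  shows "\<xi> i \<in> borel_measurable (sgd_filtration P x0 \<xi> k)"
  unfolding sgd_filtration_def
  using assms by (intro measurableI) (auto simp: space_measure_of_conv intro!: in_measure_of)

text \<open>Induction on \<open>j\<close> with \<open>k\<close> fixed: all measurability statements
  refer to the same sigma-algebra, so monotonicity of the filtration never enters. The iterate with
  index \<open>Suc j\<close> uses the noise up to index \<open>Suc j\<close>, which is at most
  \<open>k\<close>.\<close>

lemma measurable_sgd_iterate:
  fixes x \<xi> :: "nat \<Rightarrow> 'w \<Rightarrow> 'a::euclidean_space"
  assumes [measurable]: "gradf \<in> borel_measurable borel"
    and step: "\<And>k w. k \<ge> 1 \<Longrightarrow> w \<in> space P \<Longrightarrow>
      x k w = x (k - 1) w - \<alpha> k *\<^sub>R gradf (x (k - 1) w) + \<alpha> k *\<^sub>R \<xi> k w"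
    and "j \<le> k"
  shows "x j \<in> borel_measurable (sgd_filtration P (x 0) \<xi> k)"
  using \<open>j \<le> k\<close>
proof (induction j)
  case 0
  show ?case by (rule measurable_sgd_filtration_initial)
next
  case (Suc j)
  have [measurable]: "x j \<in> borel_measurable (sgd_filtration P (x 0) \<xi> k)"
    "\<xi> (Suc j) \<in> borel_measurable (sgd_filtration P (x 0) \<xi> k)"
    using Suc by (auto intro: measurable_sgd_filtration_noise)
  have "(\<lambda>w. x j w - \<alpha> (Suc j) *\<^sub>R gradf (x j w) + \<alpha> (Suc j) *\<^sub>R \<xi> (Suc j) w)
      \<in> borel_measurable (sgd_filtration P (x 0) \<xi> k)"
    by measurable
  then show ?case
    by (subst measurable_cong) (use step[of "Suc j"] in auto)
qed

section \<open>Convergence\<close>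

theorem theorem1:
  fixes f :: "'a::euclidean_space \<Rightarrow> real"
    and gradf :: "'a \<Rightarrow> 'a"
    and L M V :: real
    and \<alpha> :: "nat \<Rightarrow> real"
    and P :: "'w measure"
    and x \<xi> :: "nat \<Rightarrow> 'w \<Rightarrow> 'a"
  assumes "\<And>y. GDERIV f y :> gradf y"
    and "continuous_on UNIV gradf"
    and "L > 0"
    and "\<And>y z. norm (gradf y - gradf z) \<le> L * norm (y - z)"
    and "bdd_below (range f)"
    and "\<And>k. k \<ge> 1 \<Longrightarrow> \<alpha> k > 0"
    and "\<alpha> \<longlonglongrightarrow> 0"
    and "filterlim (\<lambda>n. \<Sum>k=1..n. \<alpha> k) at_top sequentially"
    and "prob_space P"
    and "x 0 \<in> borel_measurable P"
    and "integrable P (\<lambda>\<omega>. f (x 0 \<omega>))"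
    and "\<And>k. k \<ge> 1 \<Longrightarrow> \<xi> k \<in> borel_measurable P"
    and "\<And>k \<omega>. k \<ge> 1 \<Longrightarrow> \<omega> \<in> space P \<Longrightarrow>
      x k \<omega> = x (k - 1) \<omega> - \<alpha> k *\<^sub>R gradf (x (k - 1) \<omega>) + \<alpha> k *\<^sub>R \<xi> k \<omega>"
    and "M \<ge> 0" and "V \<ge> 0"
    and "\<And>k. k \<ge> 1 \<Longrightarrow>
      AE \<omega> in P. vec_cond_exp P (sgd_filtration P (x 0) \<xi> (k - 1)) (\<xi> k) \<omega> = 0"
    and "\<And>k. k \<ge> 1 \<Longrightarrow>
      AE \<omega> in P. nn_cond_exp P (sgd_filtration P (x 0) \<xi> (k - 1))
          (\<lambda>\<omega>'. ennreal ((norm (\<xi> k \<omega>'))\<^sup>2)) \<omega>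
        \<le> ennreal (M + V * (norm (gradf (x (k - 1) \<omega>)))\<^sup>2)"
  shows "liminf (\<lambda>n. \<integral>\<^sup>+\<omega>. ennreal ((norm (gradf (x n \<omega>)))\<^sup>2) \<partial>P) = 0 \<and>
    (summable (\<lambda>k. (\<alpha> (Suc k))\<^sup>2) \<longrightarrow>
      (\<lambda>n. \<integral>\<^sup>+\<omega>. ennreal ((norm (gradf (x n \<omega>)))\<^sup>2) \<partial>P) \<longlonglongrightarrow> 0)"
proof -
  interpret prob_space P by fact
  note moments = assms(16,17)
  obtain m where m: "\<And>y. m \<le> f y"
    using \<open>bdd_below (range f)\<close> by (auto simp: bdd_below_def)
  interpret smooth_bounded_below f gradf L m
    by unfold_locales (use assms(1,3,4) m in auto)

  \<comment> \<open>Notation, measurability and step sizes\<close>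
  define F where "F = sgd_filtration P (x 0) \<xi>"
  \<comment> \<open>The shift makes \<open>t n\<close> the size of the step from \<open>x n\<close>
    to \<open>x (Suc n)\<close>, whose noise is \<open>\<xi> (Suc n)\<close> and whose past is
    \<open>F n\<close>.\<close>
  define t where "t n = \<alpha> (Suc n)" for n
  define G where "G n = (\<integral>\<omega>. (norm (gradf (x n \<omega>)))\<^sup>2 \<partial>P)" for n
  define a where "a n = (\<integral>\<omega>. f (x n \<omega>) \<partial>P) - m" for n
  \<comment> \<open>Chosen so that \<open>L / 2 * (G n + (M + V * G n))\<close> is at most
    \<open>K * (G n + 1)\<close>.\<close>
  define K where "K = L / 2 * (1 + M + V)"
  have F: "subalgebra P (F n)" for n
    unfolding F_def using assms(10,12) by (rule subalgebra_sgd_filtration)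
  have xF: "x n \<in> borel_measurable (F n)" for n
    unfolding F_def using gradf_borel assms(13) order_refl by (rule measurable_sgd_iterate)
  then have xP: "x n \<in> borel_measurable P" for n
    using measurable_from_subalg[OF F] by blast
  have t_pos: "0 < t n" for n
    using assms(6) by (simp add: t_def)
  have t0: "t \<longlonglongrightarrow> 0"
    unfolding t_def using \<open>\<alpha> \<longlonglongrightarrow> 0\<close> by (rule LIMSEQ_Suc)
  have div: "\<not> summable t"
  proof
    assume "summable t"
    then have "(\<lambda>n. \<Sum>k<n. t k) \<longlonglongrightarrow> suminf t" by (rule summable_LIMSEQ)
    moreover have "filterlim (\<lambda>n. \<Sum>k<n. t k) at_top sequentially"
      using assms(8) by (simp add: t_def sum.atLeast1_atMost_eq)
    ultimately show False
      using not_tendsto_and_filterlim_at_infinity[OF sequentially_bot]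
        filterlim_at_top_imp_at_infinity by blast
  qed

  \<comment> \<open>Recursions for the expected values\<close>
  have nonneg: "0 \<le> M" "0 \<le> V" by fact+
  have rec: "x (Suc n) \<omega> = x n \<omega> - t n *\<^sub>R gradf (x n \<omega>) + t n *\<^sub>R \<xi> (Suc n) \<omega>"
    if "\<omega> \<in> space P" for n \<omega>
    using assms(13)[of "Suc n" \<omega>] that by (simp add: t_def)
  have mean: "AE \<omega> in P. vec_cond_exp P (F n) (\<xi> (Suc n)) \<omega> = 0" for n
    using moments(1)[of "Suc n"] by (simp add: F_def)
  have var: "AE \<omega> in P. nn_cond_exp P (F n) (\<lambda>\<omega>. ennreal ((norm (\<xi> (Suc n) \<omega>))\<^sup>2)) \<omega>
      \<le> ennreal (M + V * (norm (gradf (x n \<omega>)))\<^sup>2)" for n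
    using moments(2)[of "Suc n"] by (simp add: F_def)
  have \<xi>P: "\<xi> (Suc n) \<in> borel_measurable P" for n
    using assms(12) by simp
  \<comment> \<open>The three facts are conditional on integrability of \<open>f\<close> along the
    current iterate. The first of them is the induction step that then provides it for every
    \<open>n\<close>.\<close>
  have one_step:
    "integrable P (\<lambda>\<omega>. f (x (Suc n) \<omega>))"
    "(\<integral>\<omega>. f (x (Suc n) \<omega>) \<partial>P)
      \<le> (\<integral>\<omega>. f (x n \<omega>) \<partial>P) - t n * G n + L / 2 * (t n)\<^sup>2 * (G n + (M + V * G n))"
    "\<bar>G (Suc n) - G n\<bar>
      \<le> t n * (L * (G n + (M + V * G n) + G n) + L\<^sup>2 * t n * (G n + (M + V * G n)))"
    if "integrable P (\<lambda>\<omega>. f (x n \<omega>))" for n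
    unfolding G_def
    using sgd_step[of P "F n" "x n" "\<xi> (Suc n)" "x (Suc n)" "t n" M V,
        OF \<open>prob_space P\<close> F xF \<xi>P rec less_imp_le[OF t_pos] nonneg that mean var]
    by blast+
  have int: "integrable P (\<lambda>\<omega>. f (x n \<omega>))" for n
  proof (induction n)
    case 0
    show ?case by fact
  next
    case (Suc n)
    then show ?case by (rule one_step(1))
  qed
  have intG: "integrable P (\<lambda>\<omega>. (norm (gradf (x n \<omega>)))\<^sup>2)" for n
    by (rule integrable_norm_grad[OF _ xP int]) unfold_locales
  have G: "0 \<le> G n" for n
    by (simp add: G_def)
  have G_le: "G n \<le> 2 * L * a n" for n
  proof -
    have "G n \<le> (\<integral>\<omega>. 2 * L * (f (x n \<omega>) - m) \<partial>P)"
      unfolding G_def using intG int grad_norm_bound by (intro integral_mono) auto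
    then show ?thesis using int by (simp add: a_def prob_space)
  qed
  have a: "0 \<le> a n" for n
    using order_trans[OF G G_le[of n]] L_pos by (simp add: zero_le_mult_iff)
  have K: "0 \<le> K" using nonneg L_pos by (simp add: K_def)
  have descent: "a (Suc n) \<le> a n - t n * G n + K * (t n)\<^sup>2 * (G n + 1)" for n
  proof -
    have "G n + (M + V * G n) \<le> (1 + M + V) * (G n + 1)"
      using G[of n] nonneg by (simp add: algebra_simps)
    then have "L / 2 * (t n)\<^sup>2 * (G n + (M + V * G n)) \<le> L / 2 * (t n)\<^sup>2 * ((1 + M + V) * (G n + 1))"
      using L_pos by (intro mult_left_mono) auto
    also have "\<dots> = K * (t n)\<^sup>2 * (G n + 1)"
      by (simp add: K_def)
    finally show ?thesis
      using one_step(2)[OF int, of n] by (simp add: a_def)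
  qed

  \<comment> \<open>The limes inferior\<close>
  have small: "\<exists>\<^sub>F n in sequentially. G n < c" if "0 < c" for c
    using a t_pos K t0 div descent that by (rule frequently_small_of_descent)
  \<comment> \<open>Integrability identifies the extended expectations of the claim with the real
    numbers \<open>G n\<close>.\<close>
  have nn: "(\<integral>\<^sup>+\<omega>. ennreal ((norm (gradf (x n \<omega>)))\<^sup>2) \<partial>P) = ennreal (G n)" for n
    unfolding G_def using intG by (intro nn_integral_eq_integral) auto
  have "liminf (\<lambda>n. ennreal (G n)) = 0"
  proof (rule ccontr)
    assume "liminf (\<lambda>n. ennreal (G n)) \<noteq> 0"
    \<comment> \<open>Any number strictly between zero and the limes inferior is finite and
      eventually a lower bound of \<open>G\<close>, which contradicts \<open>small\<close>.\<close>
    then obtain c where c: "0 < c" "c < liminf (\<lambda>n. ennreal (G n))"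
      using dense[of 0 "liminf (\<lambda>n. ennreal (G n))"] by (auto simp: zero_less_iff_neq_zero)
    then obtain r where r: "c = ennreal r" "0 < r"
      by (cases c) (auto simp: top_unique)
    have "\<forall>\<^sub>F n in sequentially. \<not> G n < r"
      using less_LiminfD[OF c(2)]
      by eventually_elim (use r in \<open>auto simp: ennreal_less_iff\<close>)
    then show False
      using small[OF r(2)] by (simp add: frequently_def)
  qed

  \<comment> \<open>The limit for square-summable step sizes\<close>
  moreover have "(\<lambda>n. ennreal (G n)) \<longlonglongrightarrow> 0" if "summable (\<lambda>k. (\<alpha> (Suc k))\<^sup>2)"
  proof -
    have t2: "summable (\<lambda>n. (t n)\<^sup>2)" using that by (simp add: t_def)
    note sums = summable_of_descent[of a t G K, OF a t_pos G K t2 t0 descent]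
    obtain A where A: "\<And>n. a n \<le> A" using sums(2) by blast
    obtain T where T: "\<And>n. t n \<le> T"
      using convergent_imp_Bseq[OF convergentI[OF t0]] unfolding Bseq_def
      by (metis abs_le_D1 real_norm_def)
    define C where "C = 2 * L * A"
    have GC: "G n \<le> C" for n
      unfolding C_def using L_pos by (intro order_trans[OF G_le] mult_left_mono A) simp
    \<comment> \<open>The variation bound of one step with \<open>G n\<close> replaced by its bound
      \<open>C\<close> and the inner \<open>t n\<close> by its bound \<open>T\<close>; only the
      outer factor \<open>t n\<close> is kept.\<close>
    define B where "B = L * (C + (M + V * C) + C) + L\<^sup>2 * T * (C + (M + V * C))"
    have variation: "\<bar>G (Suc n) - G n\<bar> \<le> B * t n" for n
    proof -
      let ?D = "G n + (M + V * G n)"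
      have D: "0 \<le> ?D" "?D \<le> C + (M + V * C)"
        using G[of n] GC[of n] nonneg by (auto intro!: add_mono mult_left_mono)
      have "L * (?D + G n) + L\<^sup>2 * t n * ?D \<le> B"
        unfolding B_def using L_pos D GC[of n] T[of n] less_imp_le[OF t_pos[of n]] G[of n] nonneg
        by (intro add_mono mult_mono) (auto intro: add_nonneg_nonneg)
      from mult_right_mono[OF this less_imp_le[OF t_pos[of n]]]
      have "t n * (L * (?D + G n) + L\<^sup>2 * t n * ?D) \<le> B * t n"
        by (subst mult.commute)
      with one_step(3)[OF int, of n] show ?thesis by (rule order_trans)
    qed
    obtain l where l: "G \<longlonglongrightarrow> l"
      using convergent_of_slow_variation[of t G B, OF less_imp_le[OF t_pos] G t2 sums(1) variation]
      by (auto simp: convergent_def)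
    \<comment> \<open>A positive limit would keep \<open>G\<close> above \<open>l / 2\<close>
      eventually, against \<open>small\<close>.\<close>
    have "\<not> 0 < l"
    proof
      assume "0 < l"
      then have "\<forall>\<^sub>F n in sequentially. l / 2 < G n"
        by (intro order_tendstoD(1)[OF l]) simp
      then have "\<forall>\<^sub>F n in sequentially. \<not> G n < l / 2"
        by eventually_elim simp
      then show False
        using small[of "l / 2"] \<open>0 < l\<close> by (simp add: frequently_def)
    qed
    moreover have "0 \<le> l" using l G by (intro LIMSEQ_le_const[of G]) auto
    ultimately have "G \<longlonglongrightarrow> 0" using l by simp
    then show ?thesis using tendsto_ennrealI[of G 0 sequentially] by simp
  qed
  ultimately show ?thesis by (simp add: nn)
qed

end
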